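(* Let $A$ be an integer matrix without free bouquets, with bouquets $B_1,\dots,B_s$, bouquet-index-encoding vectors $\mathbf{c}_1,\dots,\mathbf{c}_s\in\mathbb{Z}^n$ and bouquet matrix $A_B$. Let $\bar{\mathbf{c}}=(\bar{\mathbf{c}}_1,\dots,\bar{\mathbf{c}}_s)\in\mathbb{Z}^s$, where $\bar{\mathbf{c}}_i=\sum_{k=1}^n(\mathbf{c}_i)_k$. Then the toric ideal $I_A$ is homogeneous if and only if $\bar{\mathbf{c}}\in\operatorname{Rowspan}_{\mathbb{Q}}(A_B)$.
   Context: For $A\in\mathbb{Z}^{d\times n}$ and a field $k$, the toric ideal is $I_A=\langle x^{z^+}-x^{z^-} : z\in\ker_{\mathbb{Z}}(A)\rangle\subseteq k[x_1,\dots,x_n]$, where $z=z^+-z^-$ is the decomposition into positive and negative parts. Standing assumption: $\ker_{\mathbb{Z}}(A)\cap\mathbb{N}^n=\{0\}$. $I_A$ is homogeneous if $(1,\dots,1)\in\mathbb{Z}^n$ lies in the rational row span $\operatorname{Rowspan}_{\mathbb{Q}}(A)$. Bouquets: two column indices $i,j\in[n]$ of $A$ are equivalent if there are nonzero $\alpha,\beta\in\mathbb{Q}$ with $\alpha u_i+\beta u_j=0$ for all $u\in\ker_{\mathbb{Z}}(A)$. The equivalence classes $B_1,\dots,B_s$ are the bouquets of $A$. A bouquet $B$ is free if $u_i=0$ for all $i\in B$ and all $u\in\ker_{\mathbb{Z}}(A)$. For a non-free bouquet $B_i$, the bouquet-index-encoding vector $\mathbf{c}_i\in\mathbb{Z}^n$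 is the unique integer vector with support exactly $B_i$, relatively prime nonzero entries, positive first nonzero entry, and such that for every $u\in\ker_{\mathbb{Z}}(A)$ the restriction of $u$ to the coordinates in $B_i$ is a multiple of the restriction of $\mathbf{c}_i$. The bouquet matrix $A_B$ has columns $A\mathbf{c}_1,\dots,A\mathbf{c}_s$. *)

theory Defs
  imports Jordan_Normal_Form.Matrix_Kernel
begin

text \<open>
  An integer matrix with \<open>d\<close> rows and \<open>n\<close> columns is a member of \<open>carrier_mat d n\<close>, and its
  columns are indexed by \<open>{0..<n}\<close>.  The lattice of integer kernel vectors is \<open>mat_kernel A\<close>
  taken at type \<open>int\<close>.
\<close>

definition rat_row_span :: "int mat \<Rightarrow> rat vec set" where
  "rat_row_span A = vec_space.row_space (dim_col A) (map_mat rat_of_int A)"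

text \<open>
  The toric ideal of \<open>A\<close> over a field is generated by the binomials
  \<open>x\<^sup>u - x\<^sup>v\<close> with \<open>u\<close>, \<open>v\<close> the positive and negative part of an integer kernel vector.
  It is called homogeneous if the all-ones vector lies in the rational row span of \<open>A\<close>; in this
  definition the field plays no role.
\<close>

definition toric_ideal_homogeneous :: "int mat \<Rightarrow> bool" where
  "toric_ideal_homogeneous A \<longleftrightarrow> vec (dim_col A) (\<lambda>_. 1) \<in> rat_row_span A"

definition bouquet_rel :: "int mat \<Rightarrow> (nat \<times> nat) set" where
  "bouquet_rel A = {(i, j). i < dim_col A \<and> j < dim_col A \<and>
     (\<exists>\<alpha> \<beta> :: rat. \<alpha> \<noteq> 0 \<and> \<beta> \<noteq> 0 \<and>
        (\<forall>u \<in> mat_kernel A. \<alpha> * rat_of_int (u $ i) + \<beta> * rat_of_int (u $ j) = 0))}"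

lemma bouquet_relI:
  fixes \<alpha> \<beta> :: rat
  assumes "i < dim_col A" "j < dim_col A" "\<alpha> \<noteq> 0" "\<beta> \<noteq> 0"
    and "\<And>u. u \<in> mat_kernel A \<Longrightarrow> \<alpha> * rat_of_int (u $ i) + \<beta> * rat_of_int (u $ j) = 0"
  shows "(i, j) \<in> bouquet_rel A"
  unfolding bouquet_rel_def mem_Collect_eq case_prod_conv using assms by blast

lemma bouquet_relE:
  assumes "(i, j) \<in> bouquet_rel A"
  obtains \<alpha> \<beta> :: rat where "i < dim_col A" "j < dim_col A" "\<alpha> \<noteq> 0" "\<beta> \<noteq> 0"
    "\<forall>u \<in> mat_kernel A. \<alpha> * rat_of_int (u $ i) + \<beta> * rat_of_int (u $ j) = 0"
  using assms unfolding bouquet_rel_def mem_Collect_eq case_prod_conv by blast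

lemma equiv_bouquet_rel: "equiv {0..<dim_col A} (bouquet_rel A)"
proof (rule equivI)
  show "bouquet_rel A \<subseteq> {0..<dim_col A} \<times> {0..<dim_col A}"
    by (auto simp: bouquet_rel_def)
  show "refl_on {0..<dim_col A} (bouquet_rel A)"
  proof (rule refl_onI)
    fix i assume "i \<in> {0..<dim_col A}"
    then show "(i, i) \<in> bouquet_rel A"
      by (intro bouquet_relI[where \<alpha> = 1 and \<beta> = "- 1"]) simp_all
  qed
  show "sym (bouquet_rel A)"
  proof (rule symI)
    fix i j assume "(i, j) \<in> bouquet_rel A"
    then show "(j, i) \<in> bouquet_rel A"
    proof (rule bouquet_relE)
      fix a b :: rat assume "i < dim_col A" "j < dim_col A" "a \<noteq> 0" "b \<noteq> 0"
        "\<forall>u \<in> mat_kernel A. a * rat_of_int (u $ i) + b * rat_of_int (u $ j) = 0"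
      then show ?thesis
        by (intro bouquet_relI[where \<alpha> = b and \<beta> = a]) (simp_all add: add.commute)
    qed
  qed
  show "trans (bouquet_rel A)"
  proof (rule transI)
    fix i j k assume ij: "(i, j) \<in> bouquet_rel A" and jk: "(j, k) \<in> bouquet_rel A"
    from ij obtain a b :: rat where ij': "i < dim_col A" and ab: "a \<noteq> 0" "b \<noteq> 0"
      "\<forall>u \<in> mat_kernel A. a * rat_of_int (u $ i) + b * rat_of_int (u $ j) = 0"
      by (rule bouquet_relE)
    from jk obtain c d :: rat where jk': "k < dim_col A" and cd: "c \<noteq> 0" "d \<noteq> 0"
      "\<forall>u \<in> mat_kernel A. c * rat_of_int (u $ j) + d * rat_of_int (u $ k) = 0"
      by (rule bouquet_relE)
    have "(c * a) * rat_of_int (u $ i) + (- (b * d)) * rat_of_int (u $ k) = 0"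
      if "u \<in> mat_kernel A" for u
    proof -
      have "a * rat_of_int (u $ i) + b * rat_of_int (u $ j) = 0"
        "c * rat_of_int (u $ j) + d * rat_of_int (u $ k) = 0" using that ab cd by auto
      then have "a * rat_of_int (u $ i) = - (b * rat_of_int (u $ j))"
        "c * rat_of_int (u $ j) = - (d * rat_of_int (u $ k))"
        by (simp_all add: eq_neg_iff_add_eq_0)
      then have "c * (a * rat_of_int (u $ i)) = b * (d * rat_of_int (u $ k))"
        by (simp add: mult.left_commute[of c b])
      then show ?thesis by (simp add: mult.assoc)
    qed
    moreover have "c * a \<noteq> 0" "- (b * d) \<noteq> 0" using ab cd by auto
    ultimately show "(i, k) \<in> bouquet_rel A"
      using ij' jk' by (intro bouquet_relI[where \<alpha> = "c * a" and \<beta> = "- (b * d)"])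
  qed
qed

definition bouquets :: "int mat \<Rightarrow> nat set set" where
  "bouquets A = {0..<dim_col A} // bouquet_rel A"

definition free_bouquet :: "int mat \<Rightarrow> nat set \<Rightarrow> bool" where
  "free_bouquet A B \<longleftrightarrow> (\<forall>u \<in> mat_kernel A. \<forall>i \<in> B. u $ i = 0)"

definition is_encoding_vec :: "int mat \<Rightarrow> nat set \<Rightarrow> int vec \<Rightarrow> bool" where
  "is_encoding_vec A B c \<longleftrightarrow>
     c \<in> carrier_vec (dim_col A) \<and>
     {k. k < dim_col A \<and> c $ k \<noteq> 0} = B \<and>
     Gcd ((\<lambda>k. c $ k) ` B) = 1 \<and>
     c $ (LEAST k. k < dim_col A \<and> c $ k \<noteq> 0) > 0 \<and>
     (\<forall>u \<in> mat_kernel A. \<exists>m. \<forall>k \<in> B. u $ k = m * c $ k)"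

lemma encoding_vec_ex1:
  assumes B: "B \<in> bouquets A" and nf: "\<not> free_bouquet A B"
  shows "\<exists>!c. is_encoding_vec A B c"
proof -
  let ?n = "dim_col A"
  have rel: "(i, j) \<in> bouquet_rel A" if "i \<in> B" "j \<in> B" for i j
    using quotient_eq_iff[OF equiv_bouquet_rel, of B A B i j] B that
    unfolding bouquets_def by auto
  have Bn: "k < ?n" if "k \<in> B" for k
    using rel[OF that that] unfolding bouquet_rel_def by auto
  then have fin: "finite B" by (auto intro: finite_subset[of B "{0..<?n}"])
  from nf obtain w j where w: "w \<in> mat_kernel A" and j: "j \<in> B" and wj: "w $ j \<noteq> 0"
    unfolding free_bouquet_def by auto
  have cross: "u $ i * w $ j = u $ j * w $ i" if u: "u \<in> mat_kernel A" and i: "i \<in> B" for u i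
  proof -
    from rel[OF i j] obtain a b :: rat where ab: "a \<noteq> 0" "b \<noteq> 0"
      "\<forall>u \<in> mat_kernel A. a * rat_of_int (u $ i) + b * rat_of_int (u $ j) = 0"
      by (rule bouquet_relE)
    have x: "a * rat_of_int (u $ i) = - (b * rat_of_int (u $ j))"
      and y: "a * rat_of_int (w $ i) = - (b * rat_of_int (w $ j))"
      using ab u w by (simp_all add: eq_neg_iff_add_eq_0)
    have "a * (rat_of_int (u $ i) * rat_of_int (w $ j)) =
        (a * rat_of_int (u $ i)) * rat_of_int (w $ j)" by simp
    also have "\<dots> = rat_of_int (u $ j) * (a * rat_of_int (w $ i))"
      unfolding x y by simp
    finally have "a * (rat_of_int (u $ i) * rat_of_int (w $ j)) =
        a * (rat_of_int (u $ j) * rat_of_int (w $ i))" by simp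
    then have "rat_of_int (u $ i * w $ j) = rat_of_int (u $ j * w $ i)" using ab by simp
    then show ?thesis unfolding of_int_eq_iff .
  qed
  have wi: "w $ i \<noteq> 0" if i: "i \<in> B" for i
  proof
    assume 0: "w $ i = 0"
    from rel[OF i j] obtain a b :: rat where ab: "a \<noteq> 0" "b \<noteq> 0"
      "\<forall>u \<in> mat_kernel A. a * rat_of_int (u $ i) + b * rat_of_int (u $ j) = 0"
      by (rule bouquet_relE)
    then show False using w 0 wj by fastforce
  qed
  define f where "f = (LEAST k. k \<in> B)"
  have f: "f \<in> B" unfolding f_def using j by (rule LeastI)
  have first: "(LEAST k. k < ?n \<and> c $ k \<noteq> 0) = f" if "{k. k < ?n \<and> c $ k \<noteq> 0} = B"
    for c :: "int vec"
  proof -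
    have "(\<lambda>k. k < ?n \<and> c $ k \<noteq> 0) = (\<lambda>k. k \<in> B)" using that by auto
    then show ?thesis unfolding f_def by simp
  qed
  define g where "g = Gcd ((\<lambda>k. w $ k) ` B)"
  have gd: "g dvd w $ k" if "k \<in> B" for k unfolding g_def using that by (auto intro: Gcd_dvd)
  have g0: "g \<noteq> 0" using gd[OF j] wj by auto
  define c where "c = vec ?n (\<lambda>k. if k \<in> B then sgn (w $ f) * (w $ k div g) else 0)"
  have sg: "sgn (w $ f) \<noteq> 0" using wi[OF f] by (auto simp: sgn_0_0)
  have ck: "c $ k = sgn (w $ f) * (w $ k div g)" if "k \<in> B" for k
    using that Bn[OF that] unfolding c_def by simp
  have wc: "w $ k = sgn (w $ f) * g * c $ k" if "k \<in> B" for k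
  proof -
    have "sgn (w $ f) * g * c $ k = (sgn (w $ f) * sgn (w $ f)) * (g * (w $ k div g))"
      unfolding ck[OF that] by simp
    also have "\<dots> = w $ k" using wi[OF f] gd[OF that] by (simp add: sgn_if)
    finally show ?thesis by simp
  qed
  have supp: "{k. k < ?n \<and> c $ k \<noteq> 0} = B"
  proof -
    have "c $ k \<noteq> 0" if "k \<in> B" for k using wc[OF that] wi[OF that] by auto
    moreover have "k \<in> B" if "k < ?n" "c $ k \<noteq> 0" for k
      using that unfolding c_def by (auto split: if_splits)
    ultimately show ?thesis using Bn by blast
  qed
  have gcd1: "Gcd ((\<lambda>k. c $ k) ` B) = 1"
  proof -
    define h where "h = Gcd ((\<lambda>k. c $ k) ` B)"
    have "g * h dvd w $ k" if "k \<in> B" for k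
    proof -
      have "h dvd c $ k" unfolding h_def using that by (auto intro: Gcd_dvd)
      then show ?thesis unfolding wc[OF that] by (simp add: mult_dvd_mono)
    qed
    then have "g * h dvd g" unfolding g_def[symmetric]
      by (subst (2) g_def) (auto intro: Gcd_greatest)
    then have "h dvd 1" using g0 by simp
    moreover have "h \<ge> 0" unfolding h_def by simp
    ultimately show ?thesis unfolding h_def[symmetric] by (simp add: zdvd1_eq)
  qed
  have pos: "c $ f > 0"
  proof -
    have "g \<ge> 0" unfolding g_def by simp
    then have "g > 0" using g0 by simp
    have "c $ f * g = \<bar>w $ f\<bar>"
      unfolding ck[OF f] using gd[OF f] \<open>g > 0\<close> by (simp add: abs_sgn mult.commute)
    then have "c $ f * g > 0" using wi[OF f] by simp
    then show ?thesis using \<open>g > 0\<close> by (simp add: zero_less_mult_iff)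
  qed
  have mult: "\<exists>m. \<forall>k \<in> B. u $ k = m * c $ k" if u: "u \<in> mat_kernel A" for u
  proof -
    have cr: "u $ i * c $ j = u $ j * c $ i" if i: "i \<in> B" for i
    proof -
      let ?e = "sgn (w $ f) * g"
      have "?e * (u $ i * c $ j) = ?e * (u $ j * c $ i)"
        using cross[OF u i] unfolding wc[OF i] wc[OF j] by (simp add: algebra_simps)
      then show ?thesis using sg g0 by simp
    qed
    have "c $ j dvd Gcd ((\<lambda>x. u $ j * x) ` ((\<lambda>k. c $ k) ` B))"
    proof (rule Gcd_greatest)
      fix y assume "y \<in> (\<lambda>x. u $ j * x) ` ((\<lambda>k. c $ k) ` B)"
      then obtain i where "i \<in> B" "y = u $ j * c $ i" by auto
      then show "c $ j dvd y" using cr[of i] by (metis dvd_triv_right)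
    qed
    also have "\<dots> = normalize (u $ j)" by (simp add: Gcd_mult gcd1)
    finally obtain m where m: "u $ j = c $ j * m" by auto
    have "c $ j \<noteq> 0" using supp j by auto
    have "u $ i = m * c $ i" if "i \<in> B" for i
    proof -
      have "c $ j * (u $ i) = c $ j * (m * c $ i)"
        using cr[OF that] m by (simp add: algebra_simps)
      then show ?thesis using \<open>c $ j \<noteq> 0\<close> by simp
    qed
    then show ?thesis by blast
  qed
  have ex: "is_encoding_vec A B c"
    unfolding is_encoding_vec_def using supp gcd1 pos mult first[OF supp] by (simp add: c_def)
  moreover have "c' = c" if c': "is_encoding_vec A B c'" for c'
  proof -
    have cc: "c' \<in> carrier_vec ?n" and s': "{k. k < ?n \<and> c' $ k \<noteq> 0} = B"
      and g': "Gcd ((\<lambda>k. c' $ k) ` B) = 1" and p': "c' $ f > 0"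
      and m': "\<forall>u \<in> mat_kernel A. \<exists>m. \<forall>k \<in> B. u $ k = m * c' $ k"
      using c' first[of c'] unfolding is_encoding_vec_def by auto
    from m' w obtain m where m: "\<forall>k \<in> B. w $ k = m * c' $ k" by blast
    from mult[OF w] obtain l where l: "\<forall>k \<in> B. w $ k = l * c $ k" by blast
    have "Gcd ((\<lambda>k. w $ k) ` B) = Gcd ((\<lambda>x. m * x) ` ((\<lambda>k. c' $ k) ` B))"
      using m by (simp add: image_image cong: image_cong)
    also have "\<dots> = \<bar>m\<bar>" by (simp add: Gcd_mult g')
    finally have 1: "g = \<bar>m\<bar>" unfolding g_def .
    have "Gcd ((\<lambda>k. w $ k) ` B) = Gcd ((\<lambda>x. l * x) ` ((\<lambda>k. c $ k) ` B))"
      using l by (simp add: image_image cong: image_cong)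
    also have "\<dots> = \<bar>l\<bar>" by (simp add: Gcd_mult gcd1)
    finally have "\<bar>m\<bar> = \<bar>l\<bar>" using 1 unfolding g_def by simp
    moreover have "m * c' $ f = l * c $ f" using m l f by metis
    then have "sgn m = sgn l" using p' pos by (metis mult.right_neutral sgn_mult sgn_pos)
    ultimately have ml: "m = l" by (metis mult_sgn_abs)
    have m0: "m \<noteq> 0" using m wj j by auto
    have "c' $ k = c $ k" if "k \<in> B" for k using m l ml m0 that by (metis mult_left_cancel)
    moreover have "c' $ k = c $ k" if "k < ?n" "k \<notin> B" for k
    proof -
      have "k \<notin> {k. k < ?n \<and> c' $ k \<noteq> 0}" "k \<notin> {k. k < ?n \<and> c $ k \<noteq> 0}"
        unfolding s' supp using that(2) by simp_all
      then show ?thesis using that(1) by simp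
    qed
    ultimately have "c' $ k = c $ k" if "k < ?n" for k using that by blast
    moreover have "dim_vec c = ?n" by (simp add: c_def)
    ultimately show ?thesis using cc by (intro eq_vecI) simp_all
  qed
  ultimately show ?thesis by blast
qed

definition encoding_vec :: "int mat \<Rightarrow> nat set \<Rightarrow> int vec" where
  "encoding_vec A B = (THE c. is_encoding_vec A B c)"

text \<open>The list \<open>Bs\<close> fixes the numbering of the bouquets, and hence the order of the columns.\<close>

definition bouquet_matrix :: "int mat \<Rightarrow> nat set list \<Rightarrow> int mat" where
  "bouquet_matrix A Bs = mat_of_cols (dim_row A) (map (\<lambda>B. A *\<^sub>v encoding_vec A B) Bs)"

definition encoding_sums :: "int mat \<Rightarrow> nat set list \<Rightarrow> int vec" where
  "encoding_sums A Bs = vec (length Bs) (\<lambda>i. \<Sum>k<dim_col A. encoding_vec A (Bs ! i) $ k)"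

end

theory Submission
  imports Defs
begin

text \<open>
  A vector lies in the rational row span of an integer matrix exactly when it is orthogonal to the
  integer kernel of that matrix: over a field the row space is the orthogonal complement of the
  kernel (\<open>double_orthogonal_complement\<close>), and rational kernel vectors become integral after
  clearing denominators (\<open>rat_row_span_iff_orthogonal_kernel\<close>).  Both sides of the theorem thus
  become statements about kernels.

  Let \<open>C\<close> be the matrix whose columns are the encoding vectors.  Then the bouquet matrix is
  \<open>A * C\<close>, and \<open>encoding_sums\<close> is \<open>C\<^sup>T *\<^sub>v 1\<close>, where \<open>1\<close> is the all-ones vector.
  The kernel of \<open>A\<close> is the image under \<open>C\<close> of the kernel of \<open>A * C\<close>: since the bouquets
  partition the columns and a kernel vector restricts on each bouquet to a multiple of the
  encoding vector, every kernel vector of \<open>A\<close> has the form \<open>C *\<^sub>v m\<close>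
  (\<open>mat_kernel_eq_encoding_image\<close>).  As \<open>1 \<bullet> (C *\<^sub>v m) = (C\<^sup>T *\<^sub>v 1) \<bullet> m\<close>, the vector
  \<open>1\<close> is orthogonal to the kernel of \<open>A\<close> if and only if \<open>encoding_sums\<close> is orthogonal to the
  kernel of the bouquet matrix.
\<close>

section \<open>Row spans and orthogonality to integer kernels\<close>

text \<open>
  For the nontrivial inclusion, induct on \<open>W\<close>.  When a vector \<open>w\<close> is added, either the complement
  does not shrink, or some \<open>z\<close> in the old complement has \<open>w \<bullet> z = 1\<close>; then the old complement is
  spanned by the new one and \<open>z\<close>.  If \<open>v\<close> is orthogonal to the new complement, then
  \<open>v - (v \<bullet> z) w\<close> is orthogonal to the old one, and the induction hypothesis applies to it.
\<close>
lemma (in vec_space) double_orthogonal_complement: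
  assumes "finite W" and "W \<subseteq> carrier_vec n"
  shows "orthogonal_complement (orthogonal_complement W) = span W"
proof
  show "span W \<subseteq> orthogonal_complement (orthogonal_complement W)"
  proof
    fix v assume v: "v \<in> span W"
    then have vc: "v \<in> carrier_vec n" using assms(2) by auto
    have "v \<bullet> x = 0" if x: "x \<in> orthogonal_complement W" for x
    proof -
      have "x \<in> orthogonal_complement (span W)"
        using x in_orthogonal_complement_span[OF assms(2)] by simp
      then have "x \<in> carrier_vec n" "x \<bullet> v = 0"
        using v unfolding orthogonal_complement_def by auto
      then show ?thesis using vc comm_scalar_prod by metis
    qed
    then show "v \<in> orthogonal_complement (orthogonal_complement W)"
      using vc unfolding orthogonal_complement_def by blast
  qed
next
  have "v \<in> span W"
    if "v \<in> carrier_vec n" "\<And>x. x \<in> orthogonal_complement W \<Longrightarrow> v \<bullet> x = 0" for v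
    using assms that
  proof (induction W arbitrary: v rule: finite_induct)
    case empty
    have "v $ i = 0" if "i < n" for i
    proof -
      have "unit_vec n i \<in> orthogonal_complement {}" by (simp add: orthogonal_complement_def)
      then have "v \<bullet> unit_vec n i = 0" by (rule empty.prems)
      then show ?thesis using empty.prems that by simp
    qed
    then have "v = 0\<^sub>v n" using empty.prems by (intro eq_vecI) auto
    then show ?case by (simp add: span_empty)
  next
    case (insert w W)
    have w: "w \<in> carrier_vec n" and W: "W \<subseteq> carrier_vec n" using insert.prems by auto
    have mono: "span W \<subseteq> span (insert w W)" by (intro span_is_monotone) auto
    show ?case
    proof (cases "\<exists>y \<in> orthogonal_complement W. w \<bullet> y \<noteq> 0")
      case False
      have "v \<bullet> x = 0" if x: "x \<in> orthogonal_complement W" for x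
      proof (rule insert.prems(3))
        have "x \<in> carrier_vec n" using x by (simp add: orthogonal_complement_def)
        then have "x \<bullet> w = 0" using False x w comm_scalar_prod by metis
        then show "x \<in> orthogonal_complement (insert w W)"
          using x by (simp add: orthogonal_complement_def)
      qed
      then have "v \<in> span W" using insert.prems by (intro insert.IH W) auto
      then show ?thesis using mono by blast
    next
      case True
      then obtain y where y: "y \<in> orthogonal_complement W" "w \<bullet> y \<noteq> 0" by blast
      define z where "z = inverse (w \<bullet> y) \<cdot>\<^sub>v y"
      have yc: "y \<in> carrier_vec n" using y by (simp add: orthogonal_complement_def)
      then have zc: "z \<in> carrier_vec n" by (simp add: z_def)
      have wz: "w \<bullet> z = 1" using y yc w by (simp add: z_def)
      have zW: "z \<bullet> u = 0" if u: "u \<in> W" for u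
      proof -
        have "u \<in> carrier_vec n" using u W by blast
        moreover have "y \<bullet> u = 0" using y u by (simp add: orthogonal_complement_def)
        ultimately show ?thesis using yc by (simp add: z_def)
      qed
      define v' where "v' = v - (v \<bullet> z) \<cdot>\<^sub>v w"
      have vc: "v \<in> carrier_vec n" using insert.prems by simp
      have v'c: "v' \<in> carrier_vec n" using vc w by (simp add: v'_def)
      have "v' \<in> span W"
      proof (rule insert.IH[OF W v'c])
        fix x assume x: "x \<in> orthogonal_complement W"
        then have xc: "x \<in> carrier_vec n" by (simp add: orthogonal_complement_def)
        let ?x = "x - (w \<bullet> x) \<cdot>\<^sub>v z"
        have "?x \<bullet> w = 0"
          using xc zc w wz comm_scalar_prod[OF xc w] comm_scalar_prod[OF zc w]
          by (simp add: minus_scalar_prod_distrib[where n = n])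
        moreover have "?x \<bullet> u = 0" if u: "u \<in> W" for u
        proof -
          have "u \<in> carrier_vec n" using u W by blast
          moreover have "x \<bullet> u = 0" using x u by (simp add: orthogonal_complement_def)
          ultimately show ?thesis
            using xc zc zW[OF u] by (simp add: minus_scalar_prod_distrib[where n = n])
        qed
        ultimately have "?x \<in> orthogonal_complement (insert w W)"
          using xc zc by (simp add: orthogonal_complement_def)
        then have "v \<bullet> ?x = 0" by (rule insert.prems)
        then show "v' \<bullet> x = 0"
          using vc xc zc w
          by (simp add: v'_def scalar_prod_minus_distrib[where n = n]
              minus_scalar_prod_distrib[where n = n] mult.commute)
      qed
      moreover have "w \<in> span (insert w W)" using in_own_span[of "insert w W"] w W by auto
      ultimately have "(v \<bullet> z) \<cdot>\<^sub>v w + v' \<in> span (insert w W)"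
        using mono w W span_add1[of "insert w W"] smult_in_span[of "insert w W" w] by auto
      also have "(v \<bullet> z) \<cdot>\<^sub>v w + v' = v"
        using vc w by (intro eq_vecI) (auto simp: v'_def)
      finally show ?thesis .
    qed
  qed
  then show "orthogonal_complement (orthogonal_complement W) \<subseteq> span W"
    by (auto simp: orthogonal_complement_def[of "orthogonal_complement W"])
qed

lemma (in vec_space) row_space_iff_orthogonal_kernel:
  assumes M: "M \<in> carrier_mat d n" and v: "v \<in> carrier_vec n"
  shows "v \<in> row_space M \<longleftrightarrow> (\<forall>x \<in> mat_kernel M. v \<bullet> x = 0)"
proof -
  have rows: "set (rows M) \<subseteq> carrier_vec n" using rows_carrier[of M] M by auto
  have "M *\<^sub>v x = 0\<^sub>v d \<longleftrightarrow> (\<forall>r \<in> set (rows M). x \<bullet> r = 0)" if x: "x \<in> carrier_vec n" for x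
  proof -
    have "M *\<^sub>v x = 0\<^sub>v d \<longleftrightarrow> (\<forall>i<d. row M i \<bullet> x = 0)"
      using M by (auto simp: vec_eq_iff)
    also have "\<dots> \<longleftrightarrow> (\<forall>i<d. x \<bullet> row M i = 0)"
      using M x comm_scalar_prod[OF x, of "row M _"] by auto
    also have "\<dots> \<longleftrightarrow> (\<forall>r \<in> set (rows M). x \<bullet> r = 0)"
      using M by (auto simp: rows_def)
    finally show ?thesis .
  qed
  then have "mat_kernel M = orthogonal_complement (set (rows M))"
    unfolding mat_kernel[OF M] orthogonal_complement_def by auto
  then show ?thesis
    unfolding row_space_def double_orthogonal_complement[OF finite_set rows, symmetric]
    using v by (simp add: orthogonal_complement_def[of "orthogonal_complement _"])
qed

lemma clear_denominators:
  fixes x :: "rat vec"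
  obtains c :: int and u :: "int vec"
  where "c \<noteq> 0" "dim_vec u = dim_vec x" "map_vec rat_of_int u = rat_of_int c \<cdot>\<^sub>v x"
proof -
  let ?den = "\<lambda>i. snd (quotient_of (x $ i))"
  define c where "c = (\<Prod>i<dim_vec x. ?den i)"
  have pos: "?den i > 0" for i by (rule quotient_of_denom_pos')
  have "\<exists>m. rat_of_int m = rat_of_int c * x $ i" if i: "i < dim_vec x" for i
  proof -
    have "?den i dvd c" unfolding c_def using i by (intro dvd_prodI) auto
    then obtain k where k: "c = ?den i * k" by (elim dvdE)
    have "x $ i = rat_of_int (fst (quotient_of (x $ i))) / rat_of_int (?den i)"
      by (intro quotient_of_div) simp
    then have "rat_of_int c * x $ i = rat_of_int (k * fst (quotient_of (x $ i)))"
      using pos[of i] unfolding k by (simp add: field_simps)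
    then show ?thesis by metis
  qed
  then obtain m where m: "\<And>i. i < dim_vec x \<Longrightarrow> rat_of_int (m i) = rat_of_int c * x $ i"
    by metis
  show thesis
  proof
    show "c \<noteq> 0" unfolding c_def using pos by (simp add: less_imp_neq[symmetric])
    show "map_vec rat_of_int (vec (dim_vec x) m) = rat_of_int c \<cdot>\<^sub>v x"
      using m by (intro eq_vecI) auto
  qed simp
qed

text \<open>
  Orthogonality to a vector is unaffected by scaling it, so testing against the integer kernel
  vectors is as good as testing against the rational ones.
\<close>
lemma rat_row_span_iff_orthogonal_kernel:
  assumes M: "M \<in> carrier_mat d n" and v: "v \<in> carrier_vec n"
  shows "map_vec rat_of_int v \<in> rat_row_span M \<longleftrightarrow> (\<forall>u \<in> mat_kernel M. v \<bullet> u = 0)"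
proof -
  interpret vec_space "TYPE(rat)" n .
  let ?h = rat_of_int
  have hM: "map_mat ?h M \<in> carrier_mat d n" and hv: "map_vec ?h v \<in> carrier_vec n"
    using M v by auto
  have hom: "map_vec ?h v \<bullet> map_vec ?h u = ?h (v \<bullet> u)" if "u \<in> carrier_vec n" for u
    using that v by (auto simp: scalar_prod_def)
  have ker: "map_vec ?h u \<in> mat_kernel (map_mat ?h M) \<longleftrightarrow> u \<in> mat_kernel M"
    if u: "u \<in> carrier_vec n" for u
  proof -
    have "map_mat ?h M *\<^sub>v map_vec ?h u = map_vec ?h (M *\<^sub>v u)"
      by (rule of_int_hom.mult_mat_vec_hom[OF M u, symmetric])
    then show ?thesis
      unfolding mat_kernel[OF M] mat_kernel[OF hM] using u M by (auto simp: vec_eq_iff)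
  qed
  have "(\<forall>x \<in> mat_kernel (map_mat ?h M). map_vec ?h v \<bullet> x = 0) \<longleftrightarrow>
      (\<forall>u \<in> mat_kernel M. v \<bullet> u = 0)"
  proof safe
    fix u assume a: "\<forall>x \<in> mat_kernel (map_mat ?h M). map_vec ?h v \<bullet> x = 0"
      and u: "u \<in> mat_kernel M"
    then have uc: "u \<in> carrier_vec n" using mat_kernelD[OF M] by blast
    then show "v \<bullet> u = 0" using a ker u hom[OF uc] by force
  next
    fix x assume a: "\<forall>u \<in> mat_kernel M. v \<bullet> u = 0" and x: "x \<in> mat_kernel (map_mat ?h M)"
    have xc: "x \<in> carrier_vec n" and Mx: "map_mat ?h M *\<^sub>v x = 0\<^sub>v d"
      using mat_kernelD[OF hM x] by auto
    obtain c u where c: "c \<noteq> 0" and u: "dim_vec u = dim_vec x" and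
      cu: "map_vec ?h u = ?h c \<cdot>\<^sub>v x" by (rule clear_denominators)
    have uc: "u \<in> carrier_vec n" using u xc by (metis carrier_vec_dim_vec carrier_vecD)
    have "?h c \<cdot>\<^sub>v 0\<^sub>v d = 0\<^sub>v d" by (intro eq_vecI) auto
    then have "map_vec ?h u \<in> mat_kernel (map_mat ?h M)"
      unfolding cu mat_kernel[OF hM] using xc Mx mult_mat_vec[OF hM xc] by simp
    then have "v \<bullet> u = 0" using a ker[OF uc] by blast
    then have "?h c * (map_vec ?h v \<bullet> x) = 0"
      using hom[OF uc] hv xc unfolding cu by simp
    then show "map_vec ?h v \<bullet> x = 0" using c by simp
  qed
  then show ?thesis
    using M row_space_iff_orthogonal_kernel[OF hM hv] by (simp add: rat_row_span_def)
qed

section \<open>The matrix of encoding vectors\<close>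

definition encoding_matrix :: "int mat \<Rightarrow> nat set list \<Rightarrow> int mat" where
  "encoding_matrix A Bs = mat_of_cols (dim_col A) (map (encoding_vec A) Bs)"

lemma encoding_matrix_carrier [simp]:
  "encoding_matrix A Bs \<in> carrier_mat (dim_col A) (length Bs)"
  using mat_of_cols_carrier(1)[of "dim_col A" "map (encoding_vec A) Bs"]
  by (simp add: encoding_matrix_def)

lemma encoding_matrix_dim [simp]:
  "dim_row (encoding_matrix A Bs) = dim_col A" "dim_col (encoding_matrix A Bs) = length Bs"
  by (simp_all add: encoding_matrix_def)

lemma is_encoding_vec_encoding_vec:
  assumes "B \<in> bouquets A" "\<not> free_bouquet A B"
  shows "is_encoding_vec A B (encoding_vec A B)"
  unfolding encoding_vec_def using encoding_vec_ex1[OF assms] by (rule theI')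

lemma encoding_vec_carrier:
  assumes "B \<in> bouquets A" "\<not> free_bouquet A B"
  shows "encoding_vec A B \<in> carrier_vec (dim_col A)"
  using is_encoding_vec_encoding_vec[OF assms] by (simp add: is_encoding_vec_def)

lemma bouquet_matrix_eq_mult:
  assumes "set Bs \<subseteq> bouquets A" "\<forall>B \<in> set Bs. \<not> free_bouquet A B"
  shows "bouquet_matrix A Bs = A * encoding_matrix A Bs"
proof (rule eq_matI)
  fix i j assume "i < dim_row (A * encoding_matrix A Bs)" "j < dim_col (A * encoding_matrix A Bs)"
  then have i: "i < dim_row A" and j: "j < length Bs" by auto
  have "encoding_vec A (Bs ! j) \<in> carrier_vec (dim_col A)"
    using assms j by (intro encoding_vec_carrier) auto
  then have "col (encoding_matrix A Bs) j = encoding_vec A (Bs ! j)"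
    using j by (simp add: encoding_matrix_def)
  then show "bouquet_matrix A Bs $$ (i, j) = (A * encoding_matrix A Bs) $$ (i, j)"
    using i j by (simp add: bouquet_matrix_def mat_of_cols_index)
qed (simp_all add: bouquet_matrix_def)

lemma encoding_sums_eq_transpose_mult:
  "encoding_sums A Bs = transpose_mat (encoding_matrix A Bs) *\<^sub>v vec (dim_col A) (\<lambda>_. 1)"
proof (rule eq_vecI)
  fix i assume "i < dim_vec (transpose_mat (encoding_matrix A Bs) *\<^sub>v vec (dim_col A) (\<lambda>_. 1))"
  then have "i < length Bs" by simp
  then show "encoding_sums A Bs $ i =
      (transpose_mat (encoding_matrix A Bs) *\<^sub>v vec (dim_col A) (\<lambda>_. 1)) $ i"
    by (simp add: encoding_sums_def scalar_prod_def encoding_matrix_def mat_of_cols_index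
        lessThan_atLeast0)
qed (simp add: encoding_sums_def)

text \<open>
  Take for \<open>m $ i\<close> the factor that turns the encoding vector of the \<open>i\<close>-th bouquet into the
  restriction of \<open>u\<close> to that bouquet.  In row \<open>k\<close> of the encoding matrix only the entry of the bouquet
  containing \<open>k\<close> is nonzero, so the combination agrees with \<open>u\<close> entry by entry.
\<close>
lemma kernel_vec_eq_encoding_combination:
  assumes "distinct Bs" "set Bs = bouquets A" "\<forall>B \<in> bouquets A. \<not> free_bouquet A B"
    and u: "u \<in> mat_kernel A"
  obtains m where "m \<in> carrier_vec (length Bs)" "encoding_matrix A Bs *\<^sub>v m = u"
proof -
  have enc: "is_encoding_vec A (Bs ! i) (encoding_vec A (Bs ! i))" if "i < length Bs" for i
    using assms that nth_mem by (intro is_encoding_vec_encoding_vec) auto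
  have "\<exists>m. \<forall>k \<in> Bs ! i. u $ k = m * encoding_vec A (Bs ! i) $ k" if "i < length Bs" for i
    using enc[OF that] u by (simp add: is_encoding_vec_def)
  then obtain m where
    m: "\<And>i k. i < length Bs \<Longrightarrow> k \<in> Bs ! i \<Longrightarrow> u $ k = m i * encoding_vec A (Bs ! i) $ k"
    by metis
  have uc: "u \<in> carrier_vec (dim_col A)" using u by (simp add: mat_kernel_def)
  show thesis
  proof
    show "vec (length Bs) m \<in> carrier_vec (length Bs)" by simp
    show "encoding_matrix A Bs *\<^sub>v vec (length Bs) m = u"
    proof (rule eq_vecI)
      fix k assume "k < dim_vec u"
      then have k: "k < dim_col A" using uc by simp
      then have "k \<in> \<Union> (bouquets A)"
        unfolding bouquets_def Union_quotient[OF equiv_bouquet_rel] by simp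
      then obtain j where j: "j < length Bs" "k \<in> Bs ! j"
        using assms(2) by (metis UnionE in_set_conv_nth)
      have zero: "encoding_vec A (Bs ! i) $ k = 0" if i: "i < length Bs" "i \<noteq> j" for i
      proof -
        have "Bs ! i \<noteq> Bs ! j" using assms(1) i j by (simp add: nth_eq_iff_index_eq)
        moreover have "Bs ! i \<in> bouquets A" "Bs ! j \<in> bouquets A" using assms(2) i j by auto
        ultimately have "Bs ! i \<inter> Bs ! j = {}"
          using quotient_disj[OF equiv_bouquet_rel] unfolding bouquets_def by blast
        then have "k \<notin> Bs ! i" using j by blast
        then show ?thesis using enc[OF i(1)] k by (auto simp: is_encoding_vec_def)
      qed
      have "(encoding_matrix A Bs *\<^sub>v vec (length Bs) m) $ k =
          (\<Sum>i<length Bs. encoding_vec A (Bs ! i) $ k * m i)"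
        using k
        by (simp add: scalar_prod_def encoding_matrix_def mat_of_cols_index lessThan_atLeast0)
      also have "\<dots> = (\<Sum>i<length Bs. if i = j then u $ k else 0)"
        using zero m j by (intro sum.cong) auto
      also have "\<dots> = u $ k" using j by simp
      finally show "(encoding_matrix A Bs *\<^sub>v vec (length Bs) m) $ k = u $ k" .
    qed (use uc in auto)
  qed
qed

lemma mat_kernel_eq_encoding_image:
  assumes "distinct Bs" "set Bs = bouquets A" "\<forall>B \<in> bouquets A. \<not> free_bouquet A B"
  shows "mat_kernel A = (*\<^sub>v) (encoding_matrix A Bs) ` mat_kernel (bouquet_matrix A Bs)"
proof -
  let ?C = "encoding_matrix A Bs"
  have A: "A \<in> carrier_mat (dim_row A) (dim_col A)" by simp
  have C: "?C \<in> carrier_mat (dim_col A) (length Bs)" by simp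
  have AC: "bouquet_matrix A Bs = A * ?C" using assms by (intro bouquet_matrix_eq_mult) auto
  have iff: "?C *\<^sub>v m \<in> mat_kernel A \<longleftrightarrow> m \<in> mat_kernel (bouquet_matrix A Bs)"
    if m: "m \<in> carrier_vec (length Bs)" for m
    unfolding AC mat_kernel[OF mult_carrier_mat[OF A C]] mat_kernel[OF A]
    using m mult_mat_vec_carrier[OF C m] assoc_mult_mat_vec[OF A C m] by simp
  have sub: "mat_kernel (bouquet_matrix A Bs) \<subseteq> carrier_vec (length Bs)"
    unfolding AC using mat_kernel_carrier[OF mult_carrier_mat[OF A C]] .
  show ?thesis
  proof
    show "(*\<^sub>v) ?C ` mat_kernel (bouquet_matrix A Bs) \<subseteq> mat_kernel A"
      using iff sub by blast
    show "mat_kernel A \<subseteq> (*\<^sub>v) ?C ` mat_kernel (bouquet_matrix A Bs)"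
    proof
      fix u assume u: "u \<in> mat_kernel A"
      obtain m where "m \<in> carrier_vec (length Bs)" "?C *\<^sub>v m = u"
        using kernel_vec_eq_encoding_combination[OF assms u] .
      then show "u \<in> (*\<^sub>v) ?C ` mat_kernel (bouquet_matrix A Bs)" using iff u by blast
    qed
  qed
qed

section \<open>Homogeneity\<close>

theorem theorem4p12:
  fixes A :: "int mat" and d n :: nat and Bs :: "nat set list"
  assumes "A \<in> carrier_mat d n"
    and "{u \<in> mat_kernel A. \<forall>k<n. u $ k \<ge> 0} = {0\<^sub>v n}"
    and "distinct Bs" and "set Bs = bouquets A"
    and "\<forall>B \<in> bouquets A. \<not> free_bouquet A B"
  shows "toric_ideal_homogeneous A \<longleftrightarrow>
    map_vec rat_of_int (encoding_sums A Bs) \<in> rat_row_span (bouquet_matrix A Bs)"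
proof -
  let ?C = "encoding_matrix A Bs" and ?one = "vec n (\<lambda>_. 1) :: int vec"
  have dim: "dim_col A = n" using assms(1) by simp
  have C: "?C \<in> carrier_mat n (length Bs)" using encoding_matrix_carrier[of A Bs] dim by simp
  have AB: "bouquet_matrix A Bs \<in> carrier_mat d (length Bs)"
    using assms(1) mat_of_cols_carrier(1)[of d "map (\<lambda>B. A *\<^sub>v encoding_vec A B) Bs"]
    by (simp add: bouquet_matrix_def)
  have sums: "encoding_sums A Bs \<in> carrier_vec (length Bs)" by (simp add: encoding_sums_def)
  have adjoint: "encoding_sums A Bs \<bullet> m = ?one \<bullet> (?C *\<^sub>v m)"
    if "m \<in> mat_kernel (bouquet_matrix A Bs)" for m
    unfolding encoding_sums_eq_transpose_mult dim
    using that mat_kernelD(1)[OF AB] by (intro transpose_vec_mult_scalar[OF C]) auto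
  have "vec n (\<lambda>_. 1) = map_vec rat_of_int ?one" by (intro eq_vecI) auto
  then have "toric_ideal_homogeneous A \<longleftrightarrow> (\<forall>u \<in> mat_kernel A. ?one \<bullet> u = 0)"
    unfolding toric_ideal_homogeneous_def dim
    using rat_row_span_iff_orthogonal_kernel[OF assms(1), of ?one] by simp
  also have "\<dots> \<longleftrightarrow> (\<forall>m \<in> mat_kernel (bouquet_matrix A Bs). encoding_sums A Bs \<bullet> m = 0)"
    unfolding mat_kernel_eq_encoding_image[OF assms(3-5)] using adjoint by simp
  also have "\<dots> \<longleftrightarrow>
      map_vec rat_of_int (encoding_sums A Bs) \<in> rat_row_span (bouquet_matrix A Bs)"
    using rat_row_span_iff_orthogonal_kernel[OF AB sums] by simp
  finally show ?thesis .
qed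

end
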